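(* Let $\mu$ be a Borel probability measure on $2^\omega$ and let $A\subseteq 2^\omega\times2^\omega$. If player II has a winning strategy in the two-dimensional measure game $G_2(0,A)$, then player II has a winning strategy in the measure game $G(0,B)$, where $B=\{x\in 2^\omega: \text{II has a winning strategy in } G(0,A_x)\}$ and $A_x=\{y\in 2^\omega:(x,y)\in A\}$.
   Context: $2^\omega$ is the space of infinite binary sequences with the product topology; for $t\in2^{<\omega}$, $N_t=\{x\in2^\omega:t\subseteq x\}$, and $t^\frown i$ is $t$ extended by $i$. Measure game $G(s,A)$ for $A\subseteq2^\omega$, $s\in[0,1)$: in round $n$, after II has played $t=x_0\dots x_{n-1}$, I plays $(m_{t^\frown0},m_{t^\frown1})$, then II plays $x_n$; $m_\emptyset=m_0+m_1$. I must obey: all $m_t$ rational; $m_0+m_1>s$; $0\le m_t\le\mu(N_t)$; $\mu(N_t)>0\Rightarrow m_t<\mu(N_t)$; $m_{t^\frown0}+m_{t^\frown1}=m_t$. II must obey: $x_n\in\{0,1\}$ and $m_{x_0\dots x_n}\ne0$. First rule-violator loses; otherwise II wins iff $(x_0,x_1,\dots)\in A$. The game $G_2(s,A)$ for $A\subseteq2^\omega\times2^\omega$ is the analogous game for $\mu\times\mu$: a sequence $t=(a_0,b_0)\dots(a_{n-1},b_{n-1})\in(2\times2)^{n}$ is identified with the pair $(t_0,t_1)=(a_0\dots a_{n-1},b_0\dots b_{n-1})$. In each round, after II has played $t$, I plays four numbers $m_{t^\frown(i,j)}$, $(i,j)\in2\times2$, and II plays $x_n\in 2\times 2$. I must obey: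 all $m_t$ rational; $m_{(0,0)}+m_{(0,1)}+m_{(1,0)}+m_{(1,1)}>s$; $0\le m_t\le(\mu\times\mu)(N_{t_0}\times N_{t_1})$; if $(\mu\times\mu)(N_{t_0}\times N_{t_1})>0$ then $m_t<(\mu\times\mu)(N_{t_0}\times N_{t_1})$; $\sum_{(i,j)}m_{t^\frown(i,j)}=m_t$. II must obey $x_n\in 2\times 2$ and $m_{x_0\dots x_n}\ne0$. If both follow the rules, the play of II determines a point $(x,y)\in2^\omega\times2^\omega$ (first and second coordinates of the $x_n$), and II wins iff $(x,y)\in A$. *)

theory Defs
  imports "HOL-Probability.Probability"
begin

definition cyl :: "bool list \<Rightarrow> (nat \<Rightarrow> bool) set" where
  "cyl t = {x. \<forall>i<length t. x i = t ! i}"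

text \<open>
  The one- and two-dimensional games are instances of one game in which player II picks letters
  from a finite alphabet \<open>'b\<close> (\<open>bool\<close>, respectively \<open>bool \<times> bool\<close>; the rule that II plays a letter
  is built into the type) and \<open>w t\<close> is the measure of the basic open set determined by the finite
  word \<open>t\<close>. A run consists of a sequence \<open>p\<close> of moves of player I and a sequence \<open>x\<close> of moves of
  player II: if \<open>t\<close> is the word of the first \<open>n\<close> letters of \<open>x\<close>, then \<open>p n j\<close> is the number
  $m_{t^\frown j}$ played by I in round \<open>n\<close>.
\<close>

definition word :: "(nat \<Rightarrow> 'b) \<Rightarrow> nat \<Rightarrow> 'b list" where
  "word x n = map x [0..<n]"

text \<open>The number $m_t$ for the word \<open>t\<close> of the first \<open>n\<close> letters of \<open>x\<close>.\<close>

fun node_val :: "(nat \<Rightarrow> 'b::finite \<Rightarrow> real) \<Rightarrow> (nat \<Rightarrow> 'b) \<Rightarrow> nat \<Rightarrow> real" where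
  "node_val p x 0 = (\<Sum>j\<in>UNIV. p 0 j)"
| "node_val p x (Suc n) = p n (x n)"

definition admissible :: "real \<Rightarrow> real \<Rightarrow> bool" where
  "admissible c m \<longleftrightarrow> m \<in> \<rat> \<and> 0 \<le> m \<and> m \<le> c \<and> (c > 0 \<longrightarrow> m < c)"

text \<open>The number at the empty word is fixed by the first move of I, so it is checked in round 0.\<close>

definition I_legal ::
  "('b::finite list \<Rightarrow> real) \<Rightarrow> real \<Rightarrow> (nat \<Rightarrow> 'b \<Rightarrow> real) \<Rightarrow> (nat \<Rightarrow> 'b) \<Rightarrow> nat \<Rightarrow> bool" where
  "I_legal w s p x n \<longleftrightarrow>
     (\<forall>j. admissible (w (word x n @ [j])) (p n j)) \<and>
     (\<Sum>j\<in>UNIV. p n j) = node_val p x n \<and>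
     (n = 0 \<longrightarrow> admissible (w []) (node_val p x 0) \<and> node_val p x 0 > s)"

definition II_legal :: "(nat \<Rightarrow> 'b \<Rightarrow> real) \<Rightarrow> (nat \<Rightarrow> 'b) \<Rightarrow> nat \<Rightarrow> bool" where
  "II_legal p x n \<longleftrightarrow> p n (x n) \<noteq> 0"

text \<open>Within a round I moves before II, hence the form of the first disjunct.\<close>

definition II_wins_run ::
  "('b::finite list \<Rightarrow> real) \<Rightarrow> real \<Rightarrow> (nat \<Rightarrow> 'b) set \<Rightarrow> (nat \<Rightarrow> 'b \<Rightarrow> real) \<Rightarrow> (nat \<Rightarrow> 'b) \<Rightarrow> bool"
  where
  "II_wins_run w s C p x \<longleftrightarrow>
     (\<exists>n. \<not> I_legal w s p x n \<and> (\<forall>k<n. I_legal w s p x k \<and> II_legal p x k)) \<or>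
     (\<forall>n. I_legal w s p x n \<and> II_legal p x n) \<and> x \<in> C"

text \<open>
  A strategy for II maps the list of completed rounds and the current move of I to a letter.
\<close>

type_synonym 'b II_strategy = "(('b \<Rightarrow> real) \<times> 'b) list \<Rightarrow> ('b \<Rightarrow> real) \<Rightarrow> 'b"

definition follows :: "'b II_strategy \<Rightarrow> (nat \<Rightarrow> 'b \<Rightarrow> real) \<Rightarrow> (nat \<Rightarrow> 'b) \<Rightarrow> bool" where
  "follows \<sigma> p x \<longleftrightarrow> (\<forall>n. x n = \<sigma> (map (\<lambda>k. (p k, x k)) [0..<n]) (p n))"

definition II_has_winning_strategy ::
  "('b::finite list \<Rightarrow> real) \<Rightarrow> real \<Rightarrow> (nat \<Rightarrow> 'b) set \<Rightarrow> bool" where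
  "II_has_winning_strategy w s C \<longleftrightarrow>
     (\<exists>\<sigma> :: 'b II_strategy. \<forall>p x. follows \<sigma> p x \<longrightarrow> II_wins_run w s C p x)"

definition II_wins_G :: "(nat \<Rightarrow> bool) measure \<Rightarrow> real \<Rightarrow> (nat \<Rightarrow> bool) set \<Rightarrow> bool" where
  "II_wins_G \<mu> s A \<longleftrightarrow> II_has_winning_strategy (\<lambda>t. measure \<mu> (cyl t)) s A"

definition II_wins_G2 ::
  "(nat \<Rightarrow> bool) measure \<Rightarrow> real \<Rightarrow> ((nat \<Rightarrow> bool) \<times> (nat \<Rightarrow> bool)) set \<Rightarrow> bool" where
  "II_wins_G2 \<mu> s A \<longleftrightarrow>
     II_has_winning_strategy
       (\<lambda>t. measure (\<mu> \<Otimes>\<^sub>M \<mu>) (cyl (map fst t) \<times> cyl (map snd t))) s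
       {z. (fst \<circ> z, snd \<circ> z) \<in> A}"

end

theory Submission
  imports Defs
begin

text \<open>
  Player II wins the game with \<open>s = 0\<close> iff the payoff set is conull, so the theorem is Fubini's theorem.

  If the complement of the payoff set lies in an open set \<open>U\<close> of measure less than the total mass
  declared by I, then II always moves to a word \<open>t\<close> whose mass exceeds the measure of \<open>U\<close> inside the
  cylinder of \<open>t\<close>; such a run cannot end in \<open>U\<close>.

  Conversely, let \<open>\<sigma>\<close> be a winning strategy and let I start with total mass \<open>\<epsilon>\<close>. At each position
  the letters that \<open>\<sigma>\<close> can be made to play are reached by moves whose masses, together with the measures
  of the cylinders of the unreachable letters, add up to barely more than the current mass. In the
  resulting tree of positions the dead branches have total measure barely more than \<open>\<epsilon>\<close>, and every
  other branch is a run won by II.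
\<close>

section \<open>Finite words\<close>

lemma length_word [simp]: "length (word x n) = n"
  by (simp add: word_def)

lemma word_0 [simp]: "word x 0 = []"
  by (simp add: word_def)

lemma word_Suc: "word x (Suc n) = word x n @ [x n]"
  by (simp add: word_def)

lemma word_eq_iff: "word x (length t) = t \<longleftrightarrow> (\<forall>i<length t. x i = t ! i)"
  unfolding list_eq_iff_nth_eq by (simp add: word_def)

definition extending :: "'b list set \<Rightarrow> (nat \<Rightarrow> 'b) set" where
  "extending W = {x. \<exists>n. word x n \<in> W}"

lemma open_contains_word_neighbourhood:
  fixes U :: "(nat \<Rightarrow> 'b::topological_space) set"
  assumes "open U" "x \<in> U"
  obtains n where "\<And>y. word y n = word x n \<Longrightarrow> y \<in> U"
proof -
  have "openin (product_topology (\<lambda>i::nat. euclidean :: 'b topology) UNIV) U"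
    using assms(1) by (simp add: open_fun_def)
  then obtain B where B: "x \<in> (\<Pi>\<^sub>E i\<in>UNIV. B i)" "finite {i. B i \<noteq> UNIV}" "(\<Pi>\<^sub>E i\<in>UNIV. B i) \<subseteq> U"
    using product_topology_open_contains_basis[of "\<lambda>i. euclidean" UNIV U x] assms(2) by auto
  obtain n where n: "\<And>i. B i \<noteq> UNIV \<Longrightarrow> i < n"
    using B(2) by (auto simp: finite_nat_set_iff_bounded)
  have "y \<in> U" if "word y n = word x n" for y
  proof -
    have "y i = x i" if "i < n" for i
      using \<open>word y n = word x n\<close> that by (simp add: word_def)
    then have "y i \<in> B i" for i
      using B(1) n[of i] by (cases "i < n") auto
    then show ?thesis using B(3) by auto
  qed
  then show thesis by (rule that)
qed

lemma open_eq_extending: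
  fixes U :: "(nat \<Rightarrow> 'b::topological_space) set"
  assumes "open U"
  obtains W where "U = extending W"
proof
  let ?W = "{t. \<forall>y. word y (length t) = t \<longrightarrow> y \<in> U}"
  show "U = extending ?W"
  proof (intro equalityI subsetI)
    fix x assume "x \<in> U"
    then obtain n where "\<And>y. word y n = word x n \<Longrightarrow> y \<in> U"
      using assms open_contains_word_neighbourhood by blast
    then have "word x n \<in> ?W" by simp
    then show "x \<in> extending ?W" unfolding extending_def by blast
  qed (auto simp: extending_def)
qed

lemma finite_words: "finite {t :: 'b::finite list. length t = n}"
  using finite_lists_length_eq[of "UNIV :: 'b set" n] by simp

lemma card_words: "card {t :: 'b::finite list. length t = n} = CARD('b) ^ n"
  using card_lists_length_eq[of "UNIV :: 'b set" n] by simp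

lemma sum_words_Suc:
  "(\<Sum>t | length t = Suc n. f t) = (\<Sum>t | length t = n. \<Sum>j\<in>UNIV. f (t @ [j :: 'b::finite]))"
proof -
  have "(\<Sum>t | length t = n. \<Sum>j\<in>UNIV. f (t @ [j]))
      = (\<Sum>(t, j)\<in>{t. length t = n} \<times> UNIV. f (t @ [j]))"
    by (rule sum.cartesian_product)
  also have "\<dots> = (\<Sum>t | length t = Suc n. f t)"
  proof (rule sum.reindex_bij_witness)
    fix t :: "'b list" assume "t \<in> {t. length t = Suc n}"
    then have "t \<noteq> []" by auto
    then show "(\<lambda>(t, j). t @ [j]) (butlast t, last t) = t" by simp
  qed auto
  finally show ?thesis ..
qed

lemma sum_words_le:
  fixes f :: "'b::finite list \<Rightarrow> real"
  assumes "\<And>t. (\<Sum>j\<in>UNIV. f (t @ [j])) \<le> f t + d (length t)"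
  shows "(\<Sum>t | length t = n. f t) \<le> f [] + (\<Sum>k<n. real (CARD('b) ^ k) * d k)"
proof (induction n)
  case 0
  have "{t :: 'b list. length t = 0} = {[]}" by auto
  then show ?case by simp
next
  case (Suc n)
  have "(\<Sum>t | length t = Suc n. f t) \<le> (\<Sum>t :: 'b list | length t = n. f t + d n)"
    unfolding sum_words_Suc using assms by (intro sum_mono) auto
  also have "\<dots> = (\<Sum>t | length t = n. f t) + real (CARD('b) ^ n) * d n"
    by (simp add: sum.distrib card_words)
  finally show ?case using Suc by simp
qed

section \<open>Admissible masses\<close>

lemma admissible_mono: "admissible c m \<Longrightarrow> c \<le> d \<Longrightarrow> admissible d m"
  by (auto simp: admissible_def)

lemma admissible_add_split:
  assumes "0 \<le> a" "0 \<le> b" "admissible (a + b) m"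
  obtains q where "admissible a q" "admissible b (m - q)"
proof (cases "m = 0 \<or> a = 0 \<or> b = 0")
  case True
  then have "admissible a 0 \<and> admissible b (m - 0) \<or> admissible a m \<and> admissible b (m - m)"
    using assms by (auto simp: admissible_def)
  then show thesis using that by blast
next
  case False
  then have "max 0 (m - b) < min a m"
    using assms by (auto simp: admissible_def)
  then obtain q where "q \<in> \<rat>" "max 0 (m - b) < q" "q < min a m"
    using Rats_dense_in_real by blast
  then show thesis using assms by (intro that[of q]) (auto simp: admissible_def)
qed

lemma admissible_sum_split:
  assumes "finite S" "\<And>j. j \<in> S \<Longrightarrow> 0 \<le> c j" "admissible (sum c S) m"
  obtains p where "\<And>j. j \<in> S \<Longrightarrow> admissible (c j) (p j)" "sum p S = m"
  using assms
proof (induction S arbitrary: m thesis rule: finite_induct)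
  case empty
  then show ?case by (simp add: admissible_def)
next
  case (insert a S)
  have "0 \<le> c a" "0 \<le> sum c S" "admissible (c a + sum c S) m"
    using insert by (auto intro: sum_nonneg)
  then obtain q where q: "admissible (c a) q" "admissible (sum c S) (m - q)"
    by (rule admissible_add_split)
  obtain p where p: "\<And>j. j \<in> S \<Longrightarrow> admissible (c j) (p j)" "sum p S = m - q"
    using insert.IH[OF _ _ q(2)] insert.prems(2) by auto
  have "sum (p(a := q)) S = sum p S"
    using insert.hyps by (intro sum.cong) auto
  then show ?case
    using insert.hyps p q(1) by (intro insert.prems(1)[of "p(a := q)"]) auto
qed

section \<open>Runs\<close>

lemma II_wins_run_iff:
  "II_wins_run w s C p x \<longleftrightarrow>
     (\<forall>n. (\<forall>k\<le>n. I_legal w s p x k) \<longrightarrow> II_legal p x n) \<and>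
     ((\<forall>n. I_legal w s p x n) \<longrightarrow> x \<in> C)"
  (is "?wins \<longleftrightarrow> ?II_legal \<and> ?payoff")
proof
  assume ?wins
  then show "?II_legal \<and> ?payoff"
    unfolding II_wins_run_def by (metis not_less)
next
  assume legal_and_payoff: "?II_legal \<and> ?payoff"
  show ?wins
  proof (cases "\<forall>n. I_legal w s p x n")
    case True
    then show ?thesis using legal_and_payoff by (simp add: II_wins_run_def)
  next
    case False
    then obtain n where n: "\<not> I_legal w s p x n" "\<forall>k<n. I_legal w s p x k"
      using exists_least_iff[of "\<lambda>n. \<not> I_legal w s p x n"] by blast
    then have "\<forall>k<n. II_legal p x k" using legal_and_payoff by simp
    with n show ?thesis unfolding II_wins_run_def by blast
  qed
qed

lemma II_has_winning_strategy_mono: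
  assumes "II_has_winning_strategy w s C" "C \<subseteq> D"
  shows "II_has_winning_strategy w s D"
proof -
  have "II_wins_run w s C p x \<Longrightarrow> II_wins_run w s D p x" for p x
    using assms(2) unfolding II_wins_run_iff by blast
  then show ?thesis
    using assms(1) unfolding II_has_winning_strategy_def by blast
qed

lemma node_val_le:
  assumes "\<And>k. I_legal w s p x k"
  shows "node_val p x n \<le> w (word x n)"
  using assms[of 0] assms[of "n - 1"]
  by (cases n) (simp_all add: I_legal_def admissible_def word_Suc)

type_synonym 'b history = "(('b \<Rightarrow> real) \<times> 'b) list"

definition history :: "(nat \<Rightarrow> 'b \<Rightarrow> real) \<Rightarrow> (nat \<Rightarrow> 'b) \<Rightarrow> nat \<Rightarrow> 'b history" where
  "history p x n = map (\<lambda>k. (p k, x k)) [0..<n]"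

lemma length_history [simp]: "length (history p x n) = n"
  by (simp add: history_def)

lemma nth_history [simp]: "k < n \<Longrightarrow> history p x n ! k = (p k, x k)"
  by (simp add: history_def)

lemma take_history [simp]: "k \<le> n \<Longrightarrow> take k (history p x n) = history p x k"
  by (simp add: history_def take_map)

lemma history_0 [simp]: "history p x 0 = []"
  by (simp add: history_def)

lemma history_Suc: "history p x (Suc n) = history p x n @ [(p n, x n)]"
  by (simp add: history_def)

lemma map_snd_history [simp]: "map snd (history p x n) = word x n"
  by (simp add: history_def word_def comp_def)

lemma follows_iff: "follows \<sigma> p x \<longleftrightarrow> (\<forall>n. x n = \<sigma> (history p x n) (p n))"
  by (simp add: follows_def history_def)

lemma run_extending_history:
  assumes "\<And>k. k < length h \<Longrightarrow> \<sigma> (take k h) (fst (h ! k)) = snd (h ! k)"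
  obtains p x where "follows \<sigma> p x" "history p x (length h) = h"
proof
  define p where "p k = fst (h ! k)" for k
  define H where "H = rec_nat [] (\<lambda>n g. g @ [(p n, \<sigma> g (p n))])"
  define x where "x n = \<sigma> (H n) (p n)" for n
  have H: "H 0 = []" "H (Suc n) = H n @ [(p n, x n)]" for n
    by (simp_all add: H_def x_def)
  have hist: "history p x n = H n" for n
    by (induction n) (simp_all add: H history_Suc)
  show "follows \<sigma> p x"
    by (simp add: follows_iff hist x_def)
  have "H k = take k h" if "k \<le> length h" for k
    using that
  proof (induction k)
    case (Suc k)
    then have "H k = take k h" "(p k, x k) = h ! k"
      using assms[of k] by (simp_all add: p_def x_def)
    with Suc show ?case by (simp add: H take_Suc_conv_app_nth)
  qed (simp add: H)
  then show "history p x (length h) = h" by (simp add: hist)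
qed

section \<open>Staying above a weight\<close>

lemma ex_strategy_staying_above:
  fixes u :: "real \<Rightarrow> 'b::finite list \<Rightarrow> real"
  assumes split: "\<And>m t. (\<Sum>j\<in>UNIV. u m (t @ [j])) \<le> u m t"
  obtains \<sigma> :: "'b II_strategy"
  where "\<And>p x n m. \<lbrakk>follows \<sigma> p x; m = node_val p x 0; I_legal w s p x n; u m (word x n) < node_val p x n\<rbrakk>
    \<Longrightarrow> u m (word x (Suc n)) < p n (x n)"
proof -
  define total :: "'b history \<Rightarrow> ('b \<Rightarrow> real) \<Rightarrow> real"
    where "total h p = sum (if h = [] then p else fst (hd h)) UNIV" for h p
  define \<sigma> :: "'b II_strategy"
    where "\<sigma> h p = (SOME j. u (total h p) (map snd h @ [j]) < p j)" for h p
  have "u m (word x (Suc n)) < p n (x n)"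
    if "follows \<sigma> p x" "m = node_val p x 0" "I_legal w s p x n" "u m (word x n) < node_val p x n"
    for p x n m
  proof -
    have total: "total (history p x n) (p n) = m"
      using that(2) by (cases n) (simp_all add: total_def history_def upt_rec)
    have "(\<Sum>j\<in>UNIV. u m (word x n @ [j])) < (\<Sum>j\<in>UNIV. p n j)"
      using that(3,4) split[of m "word x n"] by (simp add: I_legal_def)
    then have "\<exists>j. u m (word x n @ [j]) < p n j"
      by (meson not_less sum_mono)
    moreover have "x n = (SOME j. u m (word x n @ [j]) < p n j)"
      using that(1) by (simp add: follows_iff \<sigma>_def total)
    ultimately have "u m (word x n @ [x n]) < p n (x n)"
      using someI_ex[of "\<lambda>j. u m (word x n @ [j]) < p n j"] by simp
    then show ?thesis by (simp add: word_Suc)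
  qed
  then show thesis by (rule that)
qed

lemma II_has_winning_strategy_above_weight:
  fixes w :: "'b::finite list \<Rightarrow> real" and u :: "real \<Rightarrow> 'b list \<Rightarrow> real"
  assumes root: "\<And>m. s < m \<Longrightarrow> u m [] < m"
    and nonneg: "\<And>m t. 0 \<le> u m t"
    and split: "\<And>m t. (\<Sum>j\<in>UNIV. u m (t @ [j])) \<le> u m t"
  shows "II_has_winning_strategy w s {x. \<exists>m>s. \<forall>n. u m (word x n) < w (word x n)}"
proof -
  obtain \<sigma> :: "'b II_strategy" where
    \<sigma>: "\<And>p x n m. \<lbrakk>follows \<sigma> p x; m = node_val p x 0; I_legal w s p x n; u m (word x n) < node_val p x n\<rbrakk>
      \<Longrightarrow> u m (word x (Suc n)) < p n (x n)"
    using ex_strategy_staying_above[of u, OF split] by blast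
  have "II_wins_run w s {x. \<exists>m>s. \<forall>n. u m (word x n) < w (word x n)} p x"
    if "follows \<sigma> p x" for p x
  proof -
    define m where "m = node_val p x 0"
    have above: "u m (word x n) < node_val p x n" if "\<forall>k\<le>n. I_legal w s p x k" for n
      using that
    proof (induction n)
      case 0
      then show ?case using root by (simp add: I_legal_def m_def)
    next
      case (Suc n)
      then show ?case using \<sigma>[OF \<open>follows \<sigma> p x\<close> m_def] by simp
    qed
    have "II_legal p x n" if "\<forall>k\<le>n. I_legal w s p x k" for n
      using \<sigma>[OF \<open>follows \<sigma> p x\<close> m_def _ above[OF that]] that nonneg[of m "word x (Suc n)"]
      by (simp add: II_legal_def)
    moreover have "\<exists>m>s. \<forall>n. u m (word x n) < w (word x n)" if "\<forall>n. I_legal w s p x n"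
    proof (intro exI conjI allI)
      show "s < m" using that[rule_format, of 0] by (simp add: I_legal_def m_def)
      show "u m (word x n) < w (word x n)" for n
        using above[of n] node_val_le[of w s p x n] that by simp
    qed
    ultimately show ?thesis unfolding II_wins_run_iff by simp
  qed
  then show ?thesis unfolding II_has_winning_strategy_def by blast
qed

section \<open>The tree of cheap positions of a winning strategy\<close>

locale winning_strategy =
  fixes w :: "'b::finite list \<Rightarrow> real" and s :: real and C :: "(nat \<Rightarrow> 'b) set"
    and \<sigma> :: "'b II_strategy" and \<epsilon> :: real
  assumes weight_nonneg: "0 \<le> w t"
    and sum_weight_append_le: "(\<Sum>j\<in>UNIV. w (t @ [j])) \<le> w t"
    and winning: "follows \<sigma> p x \<Longrightarrow> II_wins_run w s C p x"
    and total_mass: "admissible (w []) \<epsilon>" "0 < \<epsilon>" "s < \<epsilon>"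
begin

text \<open>Only positions in which I declares the total mass \<open>\<epsilon>\<close> are considered.\<close>

definition current_mass :: "'b history \<Rightarrow> real" where
  "current_mass h = (if h = [] then \<epsilon> else fst (last h) (snd (last h)))"

definition legal_move :: "'b history \<Rightarrow> ('b \<Rightarrow> real) \<Rightarrow> bool" where
  "legal_move h p \<longleftrightarrow>
     (\<forall>j. admissible (w (map snd h @ [j])) (p j)) \<and> (\<Sum>j\<in>UNIV. p j) = current_mass h"

definition position :: "'b history \<Rightarrow> bool" where
  "position h \<longleftrightarrow>
     (\<forall>k<length h. legal_move (take k h) (fst (h ! k)) \<and> \<sigma> (take k h) (fst (h ! k)) = snd (h ! k))"

lemma position_Nil: "position []"
  by (simp add: position_def)

lemma position_snoc_iff:
  "position (h @ [(p, j)]) \<longleftrightarrow> position h \<and> legal_move h p \<and> \<sigma> h p = j"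
  by (auto simp: position_def nth_append less_Suc_eq)

lemma position_history_iff:
  "position (history p x n) \<longleftrightarrow>
     (\<forall>k<n. legal_move (history p x k) (p k) \<and> \<sigma> (history p x k) (p k) = x k)"
  by (simp add: position_def)

lemma I_legal_if_legal_move:
  assumes "legal_move (history p x n) (p n)"
  shows "I_legal w s p x n"
  using assms total_mass
  by (cases n) (simp_all add: legal_move_def I_legal_def current_mass_def history_Suc word_Suc)

lemma reply_nonzero:
  assumes "position h" "legal_move h q"
  shows "q (\<sigma> h q) \<noteq> 0"
proof -
  let ?h = "h @ [(q, \<sigma> h q)]" and ?n = "length h"
  have pos: "position ?h" using assms by (simp add: position_snoc_iff)
  then obtain p x where f: "follows \<sigma> p x" and "history p x (length ?h) = ?h"
    unfolding position_def by (metis run_extending_history)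
  then have hist: "history p x (Suc ?n) = ?h" by simp
  then have "p ?n = q" "x ?n = \<sigma> h q" by (simp_all add: history_Suc)
  moreover have "\<forall>k\<le>?n. I_legal w s p x k"
    using pos unfolding hist[symmetric] position_history_iff
    by (simp add: I_legal_if_legal_move less_Suc_eq_le)
  then have "II_legal p x ?n"
    using winning[OF f] unfolding II_wins_run_iff by blast
  ultimately show ?thesis by (simp add: II_legal_def)
qed

lemma admissible_current_mass:
  assumes "position h"
  shows "admissible (w (map snd h)) (current_mass h)"
proof (cases h rule: rev_cases)
  case Nil
  then show ?thesis using total_mass by (simp add: current_mass_def)
next
  case (snoc g r)
  obtain p j where r: "r = (p, j)" by (cases r)
  then have "legal_move g p"
    using assms snoc by (simp add: position_snoc_iff)
  then show ?thesis using snoc r by (simp add: legal_move_def current_mass_def)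
qed

lemma in_payoff_if_positions:
  assumes "\<And>n. position (history p x n)"
  shows "x \<in> C"
proof -
  have moves: "legal_move (history p x n) (p n) \<and> \<sigma> (history p x n) (p n) = x n" for n
    using assms[of "Suc n"] by (simp add: position_history_iff)
  then have "I_legal w s p x n" for n by (intro I_legal_if_legal_move) blast
  moreover have "follows \<sigma> p x" using moves by (simp add: follows_iff)
  ultimately show ?thesis using winning[of p x] unfolding II_wins_run_iff by blast
qed

definition accepted_masses :: "'b history \<Rightarrow> 'b \<Rightarrow> real set" where
  "accepted_masses h j = {p j | p. legal_move h p \<and> \<sigma> h p = j}"

definition price :: "'b history \<Rightarrow> 'b \<Rightarrow> real" where
  "price h j = Inf (insert (w (map snd h @ [j])) (accepted_masses h j))"

lemma bdd_below_accepted_masses: "bdd_below (accepted_masses h j)"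
  by (rule bdd_belowI[of _ 0]) (auto simp: accepted_masses_def legal_move_def admissible_def)

lemma price_le_weight: "price h j \<le> w (map snd h @ [j])"
  unfolding price_def by (rule cInf_lower) (simp_all add: bdd_below_accepted_masses)

lemma price_le_accepted:
  assumes "legal_move h p"
  shows "price h (\<sigma> h p) \<le> p (\<sigma> h p)"
  unfolding price_def
proof (rule cInf_lower)
  have "p (\<sigma> h p) \<in> accepted_masses h (\<sigma> h p)"
    using assms unfolding accepted_masses_def by blast
  then show "p (\<sigma> h p) \<in> insert (w (map snd h @ [\<sigma> h p])) (accepted_masses h (\<sigma> h p))"
    by blast
qed (simp add: bdd_below_accepted_masses)

lemma price_nonneg: "0 \<le> price h j"
  unfolding price_def
  by (rule cInf_greatest)
    (auto simp: weight_nonneg accepted_masses_def legal_move_def admissible_def)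

text \<open>Otherwise I could stay strictly below every price, and no reply would be acceptable.\<close>

lemma sum_price_le:
  assumes "position h"
  shows "(\<Sum>j\<in>UNIV. price h j) \<le> current_mass h"
proof (rule ccontr)
  assume "\<not> ?thesis"
  then have "admissible (\<Sum>j\<in>UNIV. price h j) (current_mass h)"
    using admissible_current_mass[OF assms] by (simp add: admissible_def)
  then obtain p where p: "\<And>j. admissible (price h j) (p j)" "sum p UNIV = current_mass h"
    by (rule admissible_sum_split[OF finite price_nonneg]) blast
  have legal: "legal_move h p"
    using admissible_mono[OF p(1) price_le_weight] p(2) by (simp add: legal_move_def)
  have "p (\<sigma> h p) = 0"
    using p(1)[of "\<sigma> h p"] price_le_accepted[OF legal] by (auto simp: admissible_def)
  then show False using reply_nonzero[OF assms legal] by blast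
qed

definition charge :: "'b history \<Rightarrow> real" where
  "charge h = (if position h then current_mass h else w (map snd h))"

lemma charge_nonneg: "0 \<le> charge h"
  using admissible_current_mass[of h] weight_nonneg by (auto simp: charge_def admissible_def)

lemma charge_le_weight: "charge h \<le> w (map snd h)"
  using admissible_current_mass[of h] by (simp add: charge_def admissible_def)

lemma ex_move_charge_less:
  assumes "position h" "0 < \<delta>"
  shows "\<exists>p. charge (h @ [(p, j)]) < price h j + \<delta>"
proof -
  obtain v where v: "v \<in> insert (w (map snd h @ [j])) (accepted_masses h j)" "v < price h j + \<delta>"
    using cInf_lessD[of "insert (w (map snd h @ [j])) (accepted_masses h j)" "price h j + \<delta>"] assms(2)
    unfolding price_def by auto
  from v(1) consider (full_weight) "v = w (map snd h @ [j])"
    | (accepted) p where "legal_move h p" "\<sigma> h p = j" "v = p j"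
    by (auto simp: accepted_masses_def)
  then obtain p where "charge (h @ [(p, j)]) \<le> v"
  proof cases
    case full_weight
    then show thesis using charge_le_weight[of "h @ [(undefined, j)]"] that by simp
  next
    case (accepted p)
    then have "charge (h @ [(p, j)]) = v"
      using assms(1) by (simp add: charge_def current_mass_def position_snoc_iff)
    then show thesis using that[of p] by simp
  qed
  then show ?thesis using v(2) by (meson le_less_trans)
qed

lemma ex_moves_sum_charge_le:
  assumes "0 < \<delta>"
  shows "\<exists>q. (\<Sum>j\<in>UNIV. charge (h @ [(q j, j)])) \<le> charge h + \<delta>"
proof (cases "position h")
  case True
  define d where "d = \<delta> / real CARD('b)"
  have "0 < d" using assms by (simp add: d_def)
  then obtain q where q: "\<And>j. charge (h @ [(q j, j)]) < price h j + d"
    using ex_move_charge_less[OF True] by metis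
  have "(\<Sum>j\<in>UNIV. charge (h @ [(q j, j)])) \<le> (\<Sum>j\<in>UNIV. price h j + d)"
    using q by (intro sum_mono less_imp_le)
  also have "\<dots> = (\<Sum>j\<in>UNIV. price h j) + \<delta>"
    by (simp add: sum.distrib d_def)
  also have "\<dots> \<le> charge h + \<delta>"
    using sum_price_le[OF True] True by (simp add: charge_def)
  finally show ?thesis by blast
next
  case False
  then have "(\<Sum>j\<in>UNIV. charge (h @ [(q j, j)])) \<le> charge h + \<delta>" for q
    using sum_weight_append_le[of "map snd h"] assms by (simp add: charge_def position_snoc_iff)
  then show ?thesis by blast
qed

definition history_tree :: "('b list \<Rightarrow> 'b history) \<Rightarrow> bool" where
  "history_tree F \<longleftrightarrow> F [] = [] \<and> (\<forall>t j. \<exists>p. F (t @ [j]) = F t @ [(p, j)])"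

lemma history_tree_append:
  assumes "history_tree F"
  obtains p where "F (t @ [j]) = F t @ [(p, j)]"
  using assms unfolding history_tree_def by blast

lemma map_snd_history_tree:
  assumes "history_tree F"
  shows "map snd (F t) = t"
proof (induction t rule: rev_induct)
  case Nil
  then show ?case using assms by (simp add: history_tree_def)
next
  case (snoc j t)
  obtain p where "F (t @ [j]) = F t @ [(p, j)]"
    using assms by (rule history_tree_append)
  then show ?case using snoc by simp
qed

lemma in_payoff_if_branch:
  assumes "history_tree F" "\<And>n. position (F (word x n))"
  shows "x \<in> C"
proof -
  have "\<exists>p. F (word x (Suc n)) = F (word x n) @ [(p, x n)]" for n
    using assms(1) unfolding word_Suc history_tree_def by blast
  then obtain p where p: "\<And>n. F (word x (Suc n)) = F (word x n) @ [(p n, x n)]"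
    by metis
  have "F (word x n) = history p x n" for n
    using assms(1) by (induction n) (simp_all add: p history_Suc history_tree_def)
  then show ?thesis using assms(2) in_payoff_if_positions[of p x] by simp
qed

lemma ex_cheap_history_tree:
  assumes "\<And>n. 0 < d n"
  obtains F where "history_tree F"
    "\<And>t. (\<Sum>j\<in>UNIV. charge (F (t @ [j]))) \<le> charge (F t) + d (length t)"
proof -
  have "\<forall>h. \<exists>q. (\<Sum>j\<in>UNIV. charge (h @ [(q j, j)])) \<le> charge h + d (length h)"
    using ex_moves_sum_charge_le[OF assms] by blast
  from choice[OF this] obtain Q where
    Q: "\<And>h. (\<Sum>j\<in>UNIV. charge (h @ [(Q h j, j)])) \<le> charge h + d (length h)"
    by blast
  define F where "F = foldl (\<lambda>h j. h @ [(Q h j, j)]) []"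
  have F: "F (t @ [j]) = F t @ [(Q (F t) j, j)]" for t j
    by (simp add: F_def)
  then have tree: "history_tree F" by (simp add: history_tree_def F_def)
  then have "length (F t) = length t" for t
    by (metis length_map map_snd_history_tree)
  then have "(\<Sum>j\<in>UNIV. charge (F (t @ [j]))) \<le> charge (F t) + d (length t)" for t
    using Q[of "F t"] by (simp add: F)
  with tree show thesis by (rule that)
qed

lemma ex_cheap_cover_of_complement:
  assumes "0 < \<delta>"
  obtains W where "- C \<subseteq> extending W" "\<And>t j. t \<in> W \<Longrightarrow> t @ [j] \<in> W"
    "\<And>n. (\<Sum>t | length t = n \<and> t \<in> W. w t) \<le> \<epsilon> + \<delta>"
proof -
  define d where "d n = \<delta> * (1 / 2) ^ Suc n / real (CARD('b) ^ n)" for n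
  have "0 < d n" for n using assms by (simp add: d_def)
  then obtain F where tree: "history_tree F"
    and cheap: "\<And>t. (\<Sum>j\<in>UNIV. charge (F (t @ [j]))) \<le> charge (F t) + d (length t)"
    by (rule ex_cheap_history_tree[of d]) blast
  define W where "W = {t. \<not> position (F t)}"
  have "- C \<subseteq> extending W"
    using in_payoff_if_branch[OF tree] unfolding W_def extending_def by blast
  moreover have "t @ [j] \<in> W" if "t \<in> W" for t j
  proof -
    obtain p where "F (t @ [j]) = F t @ [(p, j)]"
      using tree by (rule history_tree_append)
    then show ?thesis using that by (simp add: W_def position_snoc_iff)
  qed
  moreover have "(\<Sum>t | length t = n \<and> t \<in> W. w t) \<le> \<epsilon> + \<delta>" for n
  proof -
    have "(\<Sum>t | length t = n \<and> t \<in> W. w t) = (\<Sum>t | length t = n \<and> t \<in> W. charge (F t))"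
      by (intro sum.cong) (simp_all add: charge_def W_def map_snd_history_tree[OF tree])
    also have "\<dots> \<le> (\<Sum>t | length t = n. charge (F t))"
      by (intro sum_mono2 finite_words charge_nonneg) auto
    also have "\<dots> \<le> charge (F []) + (\<Sum>k<n. real (CARD('b) ^ k) * d k)"
      using cheap by (rule sum_words_le)
    also have "\<dots> = \<epsilon> + \<delta> * (\<Sum>k<n. (1 / 2) ^ Suc k)"
      using tree
      by (simp add: history_tree_def charge_def position_Nil current_mass_def d_def sum_distrib_left)
    also have "(\<Sum>k<n. (1 / 2 :: real) ^ Suc k) \<le> 1"
      using sum_le_suminf[OF sums_summable[OF power_half_series], of "{..<n}"]
        sums_unique[OF power_half_series] by simp
    finally show ?thesis using assms by simp
  qed
  ultimately show thesis by (intro that)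
qed

end

section \<open>The game of a random sequence\<close>

locale random_sequence = prob_space M for M :: "'a measure" +
  fixes X :: "'a \<Rightarrow> nat \<Rightarrow> 'b::finite"
  assumes measurable_letter [measurable]: "(\<lambda>a. X a n) \<in> M \<rightarrow>\<^sub>M count_space UNIV"
begin

definition cell :: "'b list \<Rightarrow> 'a set" where
  "cell t = {a \<in> space M. word (X a) (length t) = t}"

lemma cell_Nil: "cell [] = space M"
  by (simp add: cell_def)

lemma cell_append: "cell (t @ [j]) = {a \<in> cell t. X a (length t) = j}"
  by (auto simp: cell_def word_Suc)

lemma sets_cell [measurable]: "cell t \<in> events"
  unfolding cell_def word_eq_iff by measurable

lemma sum_prob_cell_append_Int:
  assumes [measurable]: "E \<in> events"
  shows "(\<Sum>j\<in>UNIV. prob (cell (t @ [j]) \<inter> E)) = prob (cell t \<inter> E)"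
proof -
  have "prob (cell t \<inter> E) = prob (\<Union>j. cell (t @ [j]) \<inter> E)"
    by (rule arg_cong[where f = prob]) (auto simp: cell_append)
  also have "\<dots> = (\<Sum>j\<in>UNIV. prob (cell (t @ [j]) \<inter> E))"
    by (rule finite_measure_finite_Union) (auto simp: cell_append disjoint_family_on_def)
  finally show ?thesis ..
qed

lemma sum_prob_cell_append: "(\<Sum>j\<in>UNIV. prob (cell (t @ [j]))) = prob (cell t)"
  using sum_prob_cell_append_Int[OF sets.top, of t] by simp

lemma word_in_eq_Union_cell:
  "{a \<in> space M. word (X a) n \<in> W} = (\<Union>t\<in>{t. length t = n \<and> t \<in> W}. cell t)"
  unfolding cell_def by force

lemma event_word_in: "{a \<in> space M. word (X a) n \<in> W} \<in> events"
  unfolding word_in_eq_Union_cell by (intro sets.finite_UN sets_cell) (simp add: finite_words)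

lemma event_extending: "{a \<in> space M. X a \<in> extending W} \<in> events"
  unfolding extending_def mem_Collect_eq by (rule sets.sets_Collect_countable_Ex[OF event_word_in])

lemma prob_extending_le:
  assumes "\<And>t j. t \<in> W \<Longrightarrow> t @ [j] \<in> W"
    and level_le: "\<And>n. (\<Sum>t | length t = n \<and> t \<in> W. prob (cell t)) \<le> c"
  shows "prob {a \<in> space M. X a \<in> extending W} \<le> c"
proof -
  let ?E = "\<lambda>n. {a \<in> space M. word (X a) n \<in> W}"
  have "prob (?E n) \<le> c" for n
  proof -
    have "prob (?E n) \<le> (\<Sum>t | length t = n \<and> t \<in> W. prob (cell t))"
      unfolding word_in_eq_Union_cell
      by (intro finite_measure_subadditive_finite) (auto simp: finite_words sets_cell)
    then show ?thesis using level_le order_trans by blast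
  qed
  moreover have "(\<lambda>n. prob (?E n)) \<longlonglongrightarrow> prob (\<Union>n. ?E n)"
  proof (rule finite_Lim_measure_incseq)
    show "incseq ?E" using assms(1) by (intro incseq_SucI) (auto simp: word_Suc)
  qed (use event_word_in in blast)
  ultimately have "prob (\<Union>n. ?E n) \<le> c"
    by (intro LIMSEQ_le_const2) blast+
  moreover have "(\<Union>n. ?E n) = {a \<in> space M. X a \<in> extending W}"
    by (auto simp: extending_def)
  ultimately show ?thesis by simp
qed

abbreviation II_wins :: "real \<Rightarrow> (nat \<Rightarrow> 'b) set \<Rightarrow> bool" where
  "II_wins s C \<equiv> II_has_winning_strategy (\<lambda>t. prob (cell t)) s C"

lemma II_wins_if_small_covers:
  assumes "\<And>r. s < r \<Longrightarrow> \<exists>W. - C \<subseteq> extending W \<and> prob {a \<in> space M. X a \<in> extending W} < r"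
  shows "II_wins s C"
proof -
  obtain W where W: "\<And>r. s < r \<Longrightarrow> - C \<subseteq> extending (W r)"
    "\<And>r. s < r \<Longrightarrow> prob {a \<in> space M. X a \<in> extending (W r)} < r"
    using assms by metis
  define E where "E r = {a \<in> space M. X a \<in> extending (W r)}" for r
  have "II_wins s {x. \<exists>m>s. \<forall>n. prob (cell (word x n) \<inter> E m) < prob (cell (word x n))}"
  proof (rule II_has_winning_strategy_above_weight)
    fix r :: real
    assume "s < r"
    moreover have "cell [] \<inter> E r = E r" by (auto simp: cell_Nil E_def)
    ultimately show "prob (cell [] \<inter> E r) < r" using W(2) by (simp add: E_def)
  qed (simp_all add: sum_prob_cell_append_Int event_extending E_def)
  moreover have "{x. \<exists>m>s. \<forall>n. prob (cell (word x n) \<inter> E m) < prob (cell (word x n))} \<subseteq> C"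
  proof (clarify, rule ccontr)
    fix x m
    assume "s < m" "x \<notin> C"
      and less: "\<forall>n. prob (cell (word x n) \<inter> E m) < prob (cell (word x n))"
    then obtain n where "word x n \<in> W m"
      using W(1)[OF \<open>s < m\<close>] by (auto simp: extending_def)
    then have "cell (word x n) \<inter> E m = cell (word x n)"
      by (auto simp: cell_def E_def extending_def intro!: exI[of _ n])
    then show False using less[rule_format, of n] by simp
  qed
  ultimately show ?thesis
    by (rule II_has_winning_strategy_mono)
qed

lemma small_cover_if_II_wins:
  assumes "II_wins s C" "0 \<le> s" "s < r"
  obtains W where "- C \<subseteq> extending W" "prob {a \<in> space M. X a \<in> extending W} < r"
proof (cases "r \<le> 1")
  case True
  obtain \<sigma> where \<sigma>: "\<And>p x. follows \<sigma> p x \<Longrightarrow> II_wins_run (\<lambda>t. prob (cell t)) s C p x"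
    using assms(1) unfolding II_has_winning_strategy_def by blast
  obtain \<epsilon> where \<epsilon>: "\<epsilon> \<in> \<rat>" "s < \<epsilon>" "\<epsilon> < r"
    using Rats_dense_in_real[OF assms(3)] by blast
  interpret winning_strategy "\<lambda>t. prob (cell t)" s C \<sigma> \<epsilon>
    using \<sigma> \<epsilon> True assms(2)
    by unfold_locales (auto simp: sum_prob_cell_append cell_Nil prob_space admissible_def)
  have "0 < (r - \<epsilon>) / 2" using \<epsilon> by simp
  then obtain W where W: "- C \<subseteq> extending W" "\<And>t j. t \<in> W \<Longrightarrow> t @ [j] \<in> W"
    "\<And>n. (\<Sum>t | length t = n \<and> t \<in> W. prob (cell t)) \<le> \<epsilon> + (r - \<epsilon>) / 2"
    by (rule ex_cheap_cover_of_complement) blast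
  have "prob {a \<in> space M. X a \<in> extending W} \<le> \<epsilon> + (r - \<epsilon>) / 2"
    using W(2,3) by (rule prob_extending_le)
  also have "\<dots> < r" using \<epsilon> by (simp add: field_simps)
  finally show thesis using W(1) that by blast
next
  case False
  have "extending UNIV = UNIV" by (simp add: extending_def)
  then show thesis using False by (intro that[of UNIV]) (auto simp: prob_space)
qed

theorem AE_if_II_wins:
  assumes "II_wins 0 C"
  shows "AE a in M. X a \<in> C"
proof -
  have "{a \<in> space M. X a \<notin> C} \<in> null_sets (completion M)"
    unfolding completion.null_sets_outer
  proof (intro allI impI)
    fix r :: real assume "0 < r"
    then obtain W where W: "- C \<subseteq> extending W" "prob {a \<in> space M. X a \<in> extending W} < r"
      using small_cover_if_II_wins[OF assms order_refl] by blast
    then show "\<exists>E\<in>fmeasurable (completion M). {a \<in> space M. X a \<notin> C} \<subseteq> E \<and> measure (completion M) E < r"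
      using event_extending
      by (intro bexI[of _ "{a \<in> space M. X a \<in> extending W}"])
        (auto intro!: fmeasurableI simp: emeasure_eq_measure)
  qed
  then have "AE a in completion M. X a \<in> C"
    by (rule AE_I') simp
  then show ?thesis by (simp add: AE_completion_iff)
qed

end

section \<open>Borel measures on sequences\<close>

lemma continuous_on_map_coordinates:
  fixes f :: "'a::topological_space \<Rightarrow> 'b::topological_space"
  assumes "continuous_on UNIV f"
  shows "continuous_on UNIV (\<lambda>x i. f (x i))"
  by (intro continuous_on_coordinatewise_then_product
      continuous_on_compose2[OF assms continuous_on_product_coordinates]) simp

lemma open_superset_measure_less_if_embedding:
  fixes \<mu> :: "'a::topological_space measure" and e :: "'a \<Rightarrow> 'b::polish_space"
  assumes "finite_measure \<mu>" "sets \<mu> = sets borel"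
    and e: "continuous_on UNIV e"
    and e' [measurable]: "e' \<in> borel_measurable borel"
    and e'_e: "\<And>x. e' (e x) = x"
    and "B \<in> sets \<mu>" "measure \<mu> B < r"
  obtains U where "open U" "B \<subseteq> U" "measure \<mu> U < r"
proof -
  interpret finite_measure \<mu> by fact
  have [measurable]: "e \<in> borel_measurable \<mu>"
    using borel_measurable_continuous_onI[OF e] measurable_cong_sets[OF assms(2) refl] by blast
  define \<nu> where "\<nu> = distr \<mu> borel e"
  interpret \<nu>: finite_measure \<nu>
    unfolding \<nu>_def by (rule finite_measure_distr) measurable
  have \<nu>: "emeasure \<nu> V = emeasure \<mu> (e -` V)" if "V \<in> sets borel" for V
    using that sets_eq_imp_space_eq[OF assms(2)] by (simp add: \<nu>_def emeasure_distr)
  have B: "e' -` B \<in> sets borel"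
    using measurable_sets[OF e', of B] assms(2) \<open>B \<in> sets \<mu>\<close> by simp
  have "e -` e' -` B = B" by (auto simp: e'_e)
  then have "emeasure \<nu> (e' -` B) < ennreal r"
    using \<open>measure \<mu> B < r\<close> by (simp add: \<nu> B emeasure_eq_measure ennreal_less_iff)
  moreover have "emeasure \<nu> (e' -` B) = (INF V\<in>{V. e' -` B \<subseteq> V \<and> open V}. emeasure \<nu> V)"
    by (rule outer_regular) (simp_all add: B, simp add: \<nu>_def)
  ultimately obtain V where V: "e' -` B \<subseteq> V" "open V" "emeasure \<nu> V < ennreal r"
    by (auto simp: INF_less_iff)
  show thesis
  proof
    show "open (e -` V)"
      using e V(2) by (simp add: continuous_on_open_vimage)
    show "B \<subseteq> e -` V" using V(1) e'_e by (metis subsetI subsetD vimageI2 vimageD)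
    show "measure \<mu> (e -` V) < r"
      using V(2,3) by (simp add: \<nu> emeasure_eq_measure ennreal_less_iff)
  qed
qed

text \<open>A discrete alphabet need not be a metric space, but its copy \<open>'b discrete\<close> is.\<close>

lemma open_superset_measure_less:
  fixes \<mu> :: "('i::countable \<Rightarrow> 'b::{countable, discrete_topology}) measure"
  assumes "finite_measure \<mu>" "sets \<mu> = sets borel" "B \<in> sets \<mu>" "measure \<mu> B < r"
  obtains U where "open U" "B \<subseteq> U" "measure \<mu> U < r"
proof (rule open_superset_measure_less_if_embedding[OF assms(1,2) _ _ _ assms(3,4)])
  show "continuous_on UNIV (\<lambda>x :: 'i \<Rightarrow> 'b. \<lambda>i. discrete (x i))"
    by (rule continuous_on_map_coordinates) simp
  show "(\<lambda>y :: 'i \<Rightarrow> 'b discrete. \<lambda>i. of_discrete (y i)) \<in> borel_measurable borel"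
    by (intro borel_measurable_continuous_onI continuous_on_map_coordinates)
      (simp add: continuous_on_open_vimage open_discrete)
qed (simp_all add: discrete_inverse that)

lemma measurable_borel_coordinate:
  fixes \<mu> :: "('i \<Rightarrow> 'b::{countable, t2_space}) measure"
  assumes "sets \<mu> = sets borel"
  shows "(\<lambda>x. x i) \<in> \<mu> \<rightarrow>\<^sub>M count_space UNIV"
  unfolding measurable_cong_sets[OF assms sets_borel_eq_count_space[symmetric]]
  by (rule measurable_product_coordinates)

lemma random_sequence_identity:
  fixes \<mu> :: "(nat \<Rightarrow> bool) measure"
  assumes "prob_space \<mu>" "sets \<mu> = sets borel"
  shows "random_sequence \<mu> (\<lambda>x. x)"
  using assms measurable_borel_coordinate[OF assms(2)]
  by (simp add: random_sequence_def random_sequence_axioms_def)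

lemma II_wins_G_if_AE:
  fixes \<mu> :: "(nat \<Rightarrow> bool) measure"
  assumes "prob_space \<mu>" "sets \<mu> = sets borel" "AE x in \<mu>. x \<in> C"
  shows "II_wins_G \<mu> 0 C"
proof -
  interpret random_sequence \<mu> "\<lambda>x. x"
    using assms(1,2) by (rule random_sequence_identity)
  have space: "space \<mu> = UNIV"
    using sets_eq_imp_space_eq[OF assms(2)] by simp
  obtain N where N: "N \<in> null_sets \<mu>" "- C \<subseteq> N"
    using assms(3) space by (auto simp: eventually_ae_filter Collect_neg_eq)
  have "II_wins 0 C"
  proof (rule II_wins_if_small_covers)
    fix r :: real assume "0 < r"
    then have "N \<in> events" "prob N < r"
      using N(1) by (auto simp: measure_def)
    then obtain U where U: "open U" "N \<subseteq> U" "prob U < r"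
      by (rule open_superset_measure_less[OF finite_measure_axioms assms(2)])
    obtain W where "U = extending W"
      using open_eq_extending[OF U(1)] .
    then show "\<exists>W. - C \<subseteq> extending W \<and> prob {x \<in> space \<mu>. x \<in> extending W} < r"
      using N(2) U(2,3) space by (intro exI[of _ W]) auto
  qed
  moreover have "cell t = cyl t" for t
    by (simp add: cell_def cyl_def word_eq_iff space)
  ultimately show ?thesis by (simp add: II_wins_G_def)
qed

lemma AE_if_II_wins_G2:
  fixes \<mu> :: "(nat \<Rightarrow> bool) measure"
  assumes "prob_space \<mu>" "sets \<mu> = sets borel" "II_wins_G2 \<mu> 0 A"
  shows "AE z in \<mu> \<Otimes>\<^sub>M \<mu>. z \<in> A"
proof -
  interpret prob_space \<mu> by fact
  interpret pair_prob_space \<mu> \<mu> ..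
  note [measurable] = measurable_borel_coordinate[OF assms(2)]
  interpret random_sequence "\<mu> \<Otimes>\<^sub>M \<mu>" "\<lambda>z n. (fst z n, snd z n)"
  proof
    have "(\<lambda>z. (fst z n, snd z n)) \<in> \<mu> \<Otimes>\<^sub>M \<mu> \<rightarrow>\<^sub>M count_space UNIV \<Otimes>\<^sub>M count_space UNIV" for n
      by measurable
    then show "(\<lambda>z. (fst z n, snd z n)) \<in> \<mu> \<Otimes>\<^sub>M \<mu> \<rightarrow>\<^sub>M count_space UNIV" for n
      by (simp add: pair_measure_countable)
  qed
  have "space \<mu> = UNIV"
    using sets_eq_imp_space_eq[OF assms(2)] by simp
  then have "cell t = cyl (map fst t) \<times> cyl (map snd t)" for t
    by (auto simp: cell_def cyl_def word_eq_iff space_pair_measure prod_eq_iff)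
  then have "II_wins 0 {z. (fst \<circ> z, snd \<circ> z) \<in> A}"
    using assms(3) by (simp add: II_wins_G2_def)
  from AE_if_II_wins[OF this] show ?thesis by (simp add: comp_def)
qed

theorem theorem4p4:
  fixes \<mu> :: "(nat \<Rightarrow> bool) measure"
    and A :: "((nat \<Rightarrow> bool) \<times> (nat \<Rightarrow> bool)) set"
  assumes "prob_space \<mu>"
    and "sets \<mu> = sets borel"
    and "II_wins_G2 \<mu> 0 A"
  shows "II_wins_G \<mu> 0 {x. II_wins_G \<mu> 0 {y. (x, y) \<in> A}}"
proof -
  interpret prob_space \<mu> by fact
  interpret pair_prob_space \<mu> \<mu> ..
  have "AE x in \<mu>. AE y in \<mu>. (x, y) \<in> A"
    using AE_if_II_wins_G2[OF assms] by (rule AE_pair)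
  then have "AE x in \<mu>. II_wins_G \<mu> 0 {y. (x, y) \<in> A}"
    by eventually_elim (simp add: II_wins_G_if_AE assms(1,2))
  then show ?thesis
    by (simp add: II_wins_G_if_AE assms(1,2))
qed

end
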